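(* For every $\Lambda\ge1$, the function $h_\Lambda(p)=\dfrac{\Lambda p}{1+(\Lambda-1)p}$ is increasing and concave on $[0,1]$. *)

theory Defs
  imports "HOL-Analysis.Analysis"
begin

(* For \<Lambda> >= 1 the denominator is at least 1 on [0,1], so the convention x / 0 = 0
   plays no role there. *)
definition h :: "real \<Rightarrow> real \<Rightarrow> real" where
  "h \<Lambda> p = \<Lambda> * p / (1 + (\<Lambda> - 1) * p)"

end

theory Submission
  imports Defs
begin

text \<open>Write D(p) = 1 + (\<Lambda> - 1) p, which is positive for p \<ge> 0. Strict monotonicity
  needs no calculus: by \<open>h_diff\<close> an increment of \<open>h \<Lambda>\<close> is
  \<Lambda> (q - p) over a product of two values of D. Concavity follows from the sign of the second
  derivative -2 \<Lambda> (\<Lambda> - 1) / D^3 (\<open>h_deriv\<close>, \<open>h_deriv2\<close>);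
  it vanishes for \<Lambda> = 1, where h is the identity.\<close>

lemma denominator_pos:
  fixes \<Lambda> p :: real
  assumes "\<Lambda> \<ge> 1" "p \<ge> 0"
  shows "1 + (\<Lambda> - 1) * p > 0"
  using assms by (simp add: add_pos_nonneg)

text \<open>Over the common denominator the terms \<Lambda> (\<Lambda> - 1) p q cancel, so the sign
  of the increment can be read off.\<close>

lemma h_diff:
  assumes "1 + (\<Lambda> - 1) * p \<noteq> 0" "1 + (\<Lambda> - 1) * q \<noteq> 0"
  shows "h \<Lambda> q - h \<Lambda> p = \<Lambda> * (q - p) / ((1 + (\<Lambda> - 1) * q) * (1 + (\<Lambda> - 1) * p))"
  unfolding h_def diff_frac_eq[OF assms(2,1)] by (simp add: algebra_simps)

text \<open>In the quotient rule the numerator \<Lambda> D - \<Lambda> p (\<Lambda> - 1) collapses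
  to \<Lambda>.\<close>

lemma h_deriv:
  assumes "1 + (\<Lambda> - 1) * p \<noteq> 0"
  shows "(h \<Lambda> has_real_derivative \<Lambda> / (1 + (\<Lambda> - 1) * p)^2) (at p)"
  unfolding h_def[abs_def] using assms
  by (auto intro!: derivative_eq_intros simp: power2_eq_square algebra_simps)

lemma h_deriv2:
  assumes "1 + (\<Lambda> - 1) * p \<noteq> 0"
  shows "((\<lambda>p. \<Lambda> / (1 + (\<Lambda> - 1) * p)^2) has_real_derivative
            - (2 * \<Lambda> * (\<Lambda> - 1) / (1 + (\<Lambda> - 1) * p)^3)) (at p)"
proof -
  \<comment> \<open>The quotient rule squares the denominator d^2 to d^4; one factor d cancels
    against the derivative of d^2.\<close>
  have *: "\<Lambda> * (2 * (c * d)) / d^4 = 2 * \<Lambda> * c / d^3" if "d \<noteq> 0" for d c :: real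
    using that by (simp add: divide_simps eval_nat_numeral)
  show ?thesis
    using assms *[OF assms, of "\<Lambda> - 1"] by (auto intro!: derivative_eq_intros)
qed

theorem lemma2:
  fixes \<Lambda> :: real
  assumes "\<Lambda> \<ge> 1"
  shows "strict_mono_on {0..1} (h \<Lambda>) \<and> concave_on {0..1} (h \<Lambda>)"
proof
  note pos = denominator_pos[OF assms]
  show "strict_mono_on {0..1} (h \<Lambda>)"
  proof (rule strict_mono_onI)
    fix p q :: real
    assume pq: "p \<in> {0..1}" "q \<in> {0..1}" "p < q"
    then have "1 + (\<Lambda> - 1) * p > 0" "1 + (\<Lambda> - 1) * q > 0"
      using pos by auto
    moreover from this have "h \<Lambda> q - h \<Lambda> p > 0"
      using pq assms by (subst h_diff) auto
    ultimately show "h \<Lambda> p < h \<Lambda> q" by simp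
  qed
  show "concave_on {0..1} (h \<Lambda>)"
  \<comment> \<open>Two-sided derivatives are required even at 0 and 1; they exist because D is
    nonzero there.\<close>
  proof (rule f''_le0_imp_concave)
    fix p :: real
    assume "p \<in> {0..1}"
    then have d: "1 + (\<Lambda> - 1) * p > 0" using pos by auto
    then show "(h \<Lambda> has_real_derivative \<Lambda> / (1 + (\<Lambda> - 1) * p)^2) (at p)"
      by (intro h_deriv) simp
    from d show "((\<lambda>p. \<Lambda> / (1 + (\<Lambda> - 1) * p)^2) has_real_derivative
            - (2 * \<Lambda> * (\<Lambda> - 1) / (1 + (\<Lambda> - 1) * p)^3)) (at p)"
      by (intro h_deriv2) simp
    from d assms show "- (2 * \<Lambda> * (\<Lambda> - 1) / (1 + (\<Lambda> - 1) * p)^3) \<le> 0" by simp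
  qed simp
qed

end
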